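(* Let $\mathcal{F}$ be a saturated fusion system over a finite $p$-group $S$, and let $\mathcal{P}^*$ be a set of fully normalized representatives for the $\mathcal{F}$-conjugacy classes of subgroups of $S$. For $Q^*,P^*\in\mathcal{P}^*$, let $\mathfrak{tBC}_{\mathcal{F}}(Q^*,P^* )$ denote the set of all tethered $\mathcal{F}$-broken chains linking $Q^*$ to $P^*$. Then the numbers of fixed points of the irreducible $\mathcal{F}$-stable sets $\alpha_{P^*}$, $P^*\in\mathcal{P}^*$, are $$\left|(\alpha_{P^*})^{Q^*}\right|=|W_SP^*|\cdot\sum_{\sigma\in\mathfrak{tBC}_{\mathcal{F}}(Q^*,P^* )}(-1)^{\ell(\sigma)}$$ for all $Q^*,P^*\in\mathcal{P}^*$.
   Context: A fusion system $\mathcal{F}$ on a finite $p$-group $S$, and its being saturated, are meant in the standard sense (Aschbacher–Kessar–Oliver). Subgroups $P,Q\le S$ are $\mathcal{F}$-conjugate, written $P\sim_{\mathcal{F}}Q$, if they are isomorphic in $\mathcal{F}$. A subgroup $P$ is fully normalized (in $\mathcal{F}$) if $|N_S(P)|\ge |N_S(P')|$ for all $P'\sim_{\mathcal{F}}P$. Write $W_SP:=N_S(P)/P$. The set $\mathcal{P}^*$ contains exactly one subgroup from each $\mathcal{F}$-conjugacy class. For a finite $S$-set $X$ and $Q\le S$, $X^Q$ is the set of $Q$-fixed points and $c_Q(X)$ is the number of orbits of $X$ isomorphic to $S/Q$. A finite $S$-set $X$ is $\mathcal{F}$-stable if for all $P\le S$ and all $\varphi\in\mathcal{F}(P,S)$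 the $P$-set obtained by restricting the action along $\varphi$ is isomorphic to the $P$-set obtained by restricting along the inclusion; equivalently, $|X^P|=|X^{Q}|$ whenever $P\sim_{\mathcal{F}}Q$. It is known (Reeh) that for each $\mathcal{F}$-conjugacy class $[P]_{\mathcal{F}}$ there is a unique (up to $S$-isomorphism) $\mathcal{F}$-stable $S$-set $\alpha_P$ such that (1) $c_Q(\alpha_P)=1$ if $Q$ is fully normalized and $Q\sim_{\mathcal{F}}P$; (2) $c_Q(\alpha_P)=0$ if $Q$ is fully normalized and $Q\not\sim_{\mathcal{F}}P$. The $\alpha_P$ are the irreducible $\mathcal{F}$-stable sets, i.e. those not expressible as disjoint unions of smaller $\mathcal{F}$-stable sets. Let $\mathcal{P}$ be the poset of all subgroups of $S$ under inclusion. A chain in $\mathcal{P}$ is a sequence $\tau=(a_0<a_1<\dots<a_n)$ with $n\ge 0$; its length is $|\tau|:=n$. A tethered $\mathcal{F}$-broken chain linking $Q^*\in\mathcal{P}^*$ to $P\in\mathcal{P}$ is a sequence of chains $\sigma=(\sigma_1,\dots,\sigma_k)$ in $\mathcal{P}$, with $\sigma_i=(a^i_0<\dots<a^i_{n_i})$, such that (i) $a^i_{n_i}\sim_{\mathcal{F}}a^{i+1}_0$ for $1\le i\le k-1$; (ii) $a^i_0\in\mathcal{P}^*$ for $1\le i\le k$; (iii) $|\sigma_i|=n_i>0$ for $1\le i\le k$; (iv) $a^1_0=Q^*$ and $a^k_{n_k}\sim_{\mathcal{F}}P$. The trivial (empty) broken chain with $k=0$ is allowed exactly when $Q^*\sim_{\mathcal{F}}P$.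 The total length is $\ell(\sigma):=k+|\sigma_1|+\dots+|\sigma_k|$. *)

theory Defs
  imports "HOL-Algebra.Group_Action" "HOL-Algebra.Left_Coset" "HOL-Computational_Algebra.Primes"
begin

section \<open>Saturated fusion systems\<close>

locale finite_p_group = group S for S (structure) +
  fixes p :: nat
  assumes prime_p: "prime p"
    and order_power: "\<exists>n. order S = p ^ n"

text \<open>
  All homomorphisms between subgroups are extensional functions (undefined outside their
  source), so that different functions are different morphisms. In the terms
  \<open>F P Q\<close> below, \<open>F\<close> assigns to subgroups \<open>P\<close> and \<open>Q\<close> the set of morphisms from
  \<open>P\<close> to \<open>Q\<close>; its values at sets that are not subgroups of \<open>S\<close> are irrelevant.
\<close>

definition conj_map :: "('a, 'b) monoid_scheme \<Rightarrow> 'a set \<Rightarrow> 'a \<Rightarrow> 'a \<Rightarrow> 'a" where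
  "conj_map S P g = (\<lambda>x\<in>P. g \<otimes>\<^bsub>S\<^esub> x \<otimes>\<^bsub>S\<^esub> inv\<^bsub>S\<^esub> g)"

definition Hom_grp :: "('a, 'b) monoid_scheme \<Rightarrow> 'a set \<Rightarrow> 'a set \<Rightarrow> ('a \<Rightarrow> 'a) set" where
  "Hom_grp S P Q = {conj_map S P g | g. g \<in> carrier S \<and> conj_map S P g ` P \<subseteq> Q}"

definition Inj_grp :: "('a, 'b) monoid_scheme \<Rightarrow> 'a set \<Rightarrow> 'a set \<Rightarrow> ('a \<Rightarrow> 'a) set" where
  "Inj_grp S P Q =
     {\<phi> \<in> hom (S\<lparr>carrier := P\<rparr>) (S\<lparr>carrier := Q\<rparr>). inj_on \<phi> P \<and> \<phi> \<in> extensional P}"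

definition fusion_iso ::
  "('a set \<Rightarrow> 'a set \<Rightarrow> ('a \<Rightarrow> 'a) set) \<Rightarrow> 'a set \<Rightarrow> 'a set \<Rightarrow> ('a \<Rightarrow> 'a) set" where
  "fusion_iso F P Q =
     {\<phi> \<in> F P Q. \<exists>\<psi> \<in> F Q P. compose P \<psi> \<phi> = (\<lambda>x\<in>P. x) \<and> compose Q \<phi> \<psi> = (\<lambda>x\<in>Q. x)}"

definition fusion_conj :: "('a set \<Rightarrow> 'a set \<Rightarrow> ('a \<Rightarrow> 'a) set) \<Rightarrow> 'a set \<Rightarrow> 'a set \<Rightarrow> bool" where
  "fusion_conj F P Q \<longleftrightarrow> fusion_iso F P Q \<noteq> {}"

text \<open>
  Identities need no axiom, as they are conjugations by \<open>\<one>\<close>. In \<open>factorization\<close>, composing with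
  the inclusion of \<open>R\<close> into \<open>Q\<close> does not change the underlying function.
\<close>

locale fusion_system = finite_p_group +
  fixes F :: "'a set \<Rightarrow> 'a set \<Rightarrow> ('a \<Rightarrow> 'a) set"
  assumes comp_closed:
      "\<lbrakk>subgroup P S; subgroup Q S; subgroup R S; \<phi> \<in> F P Q; \<psi> \<in> F Q R\<rbrakk>
        \<Longrightarrow> compose P \<psi> \<phi> \<in> F P R"
    and Hom_grp_subset: "\<lbrakk>subgroup P S; subgroup Q S\<rbrakk> \<Longrightarrow> Hom_grp S P Q \<subseteq> F P Q"
    and subset_Inj_grp: "\<lbrakk>subgroup P S; subgroup Q S\<rbrakk> \<Longrightarrow> F P Q \<subseteq> Inj_grp S P Q"
    and factorization: "\<lbrakk>subgroup P S; subgroup Q S; \<phi> \<in> F P Q\<rbrakk>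
        \<Longrightarrow> \<exists>R. subgroup R S \<and> R \<subseteq> Q \<and> \<phi> \<in> fusion_iso F P R"

definition sylow_subgroup :: "nat \<Rightarrow> 'a set \<Rightarrow> ('a, 'b) monoid_scheme \<Rightarrow> bool" where
  "sylow_subgroup p H G \<longleftrightarrow> subgroup H G \<and> card H = p ^ multiplicity p (order G)"

definition Aut_group ::
  "('a set \<Rightarrow> 'a set \<Rightarrow> ('a \<Rightarrow> 'a) set) \<Rightarrow> 'a set \<Rightarrow> ('a \<Rightarrow> 'a) monoid" where
  "Aut_group F P = BijGroup P\<lparr>carrier := fusion_iso F P P\<rparr>"

definition fully_automized ::
  "('a, 'b) monoid_scheme \<Rightarrow> nat \<Rightarrow> ('a set \<Rightarrow> 'a set \<Rightarrow> ('a \<Rightarrow> 'a) set) \<Rightarrow> 'a set \<Rightarrow> bool" where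
  "fully_automized S p F P \<longleftrightarrow> sylow_subgroup p (Hom_grp S P P) (Aut_group F P)"

text \<open>
  For \<open>\<phi> : Q \<rightarrow> P\<close> this is the group usually written \<open>N\<^sub>\<phi>\<close>: the elements \<open>g\<close> of the normalizer
  of \<open>Q\<close> for which \<open>\<phi> \<circ> c\<^sub>g \<circ> inv \<phi>\<close> is induced by conjugation in \<open>S\<close>.
\<close>

definition extension_domain ::
  "('a, 'b) monoid_scheme \<Rightarrow> 'a set \<Rightarrow> 'a set \<Rightarrow> ('a \<Rightarrow> 'a) \<Rightarrow> 'a set" where
  "extension_domain S Q P \<phi> =
     {g \<in> normalizer S Q. (\<lambda>x\<in>P. \<phi> (conj_map S Q g (inv_into Q \<phi> x))) \<in> Hom_grp S P P}"

definition receptive ::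
  "('a, 'b) monoid_scheme \<Rightarrow> ('a set \<Rightarrow> 'a set \<Rightarrow> ('a \<Rightarrow> 'a) set) \<Rightarrow> 'a set \<Rightarrow> bool" where
  "receptive S F P \<longleftrightarrow>
     (\<forall>Q \<phi>. subgroup Q S \<and> \<phi> \<in> fusion_iso F Q P \<longrightarrow>
        (\<exists>\<psi> \<in> F (extension_domain S Q P \<phi>) (carrier S). restrict \<psi> Q = \<phi>))"

locale saturated_fusion_system = fusion_system +
  assumes saturated: "subgroup P S \<Longrightarrow>
    \<exists>Q. subgroup Q S \<and> fusion_conj F P Q \<and> fully_automized S p F Q \<and> receptive S F Q"

definition fully_normalized ::
  "('a, 'b) monoid_scheme \<Rightarrow> ('a set \<Rightarrow> 'a set \<Rightarrow> ('a \<Rightarrow> 'a) set) \<Rightarrow> 'a set \<Rightarrow> bool" where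
  "fully_normalized S F P \<longleftrightarrow> subgroup P S \<and>
     (\<forall>P'. subgroup P' S \<and> fusion_conj F P' P \<longrightarrow> card (normalizer S P') \<le> card (normalizer S P))"

definition W_grp :: "('a, 'b) monoid_scheme \<Rightarrow> 'a set \<Rightarrow> 'a set monoid" where
  "W_grp S P = S\<lparr>carrier := normalizer S P\<rparr> Mod P"

definition conj_class_reps ::
  "('a, 'b) monoid_scheme \<Rightarrow> ('a set \<Rightarrow> 'a set \<Rightarrow> ('a \<Rightarrow> 'a) set) \<Rightarrow> 'a set set \<Rightarrow> bool" where
  "conj_class_reps S F \<P> \<longleftrightarrow>
     (\<forall>P\<in>\<P>. subgroup P S) \<and> (\<forall>P. subgroup P S \<longrightarrow> (\<exists>!Q. Q \<in> \<P> \<and> fusion_conj F Q P))"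


section \<open>Stable sets\<close>

text \<open>
  Here \<open>H\<close> is only the underlying set of the acting group, so that orbits, and restrictions of
  actions to subgroups, can be compared without restricting the acting functions.
\<close>

definition gset_isomorphic ::
  "'a set \<Rightarrow> 'x set \<Rightarrow> ('a \<Rightarrow> 'x \<Rightarrow> 'x) \<Rightarrow> 'y set \<Rightarrow> ('a \<Rightarrow> 'y \<Rightarrow> 'y) \<Rightarrow> bool" where
  "gset_isomorphic H X \<theta> Y \<eta> \<longleftrightarrow>
     (\<exists>f. bij_betw f X Y \<and> (\<forall>h\<in>H. \<forall>x\<in>X. f (\<theta> h x) = \<eta> h (f x)))"

definition fixed_points :: "'x set \<Rightarrow> ('a \<Rightarrow> 'x \<Rightarrow> 'x) \<Rightarrow> 'a set \<Rightarrow> 'x set" where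
  "fixed_points X \<theta> Q = {x \<in> X. \<forall>g\<in>Q. \<theta> g x = x}"

definition orbit_count ::
  "('a, 'b) monoid_scheme \<Rightarrow> 'x set \<Rightarrow> ('a \<Rightarrow> 'x \<Rightarrow> 'x) \<Rightarrow> 'a set \<Rightarrow> nat" where
  "orbit_count S X \<theta> Q =
     card {Y \<in> orbits S X \<theta>.
       gset_isomorphic (carrier S) Y \<theta> (lcosets\<^bsub>S\<^esub> Q) (\<lambda>g C. g <#\<^bsub>S\<^esub> C)}"

definition stable_set ::
  "('a, 'b) monoid_scheme \<Rightarrow> ('a set \<Rightarrow> 'a set \<Rightarrow> ('a \<Rightarrow> 'a) set) \<Rightarrow> 'x set \<Rightarrow> ('a \<Rightarrow> 'x \<Rightarrow> 'x) \<Rightarrow> bool"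
  where
  "stable_set S F X \<theta> \<longleftrightarrow> group_action S X \<theta> \<and> finite X \<and>
     (\<forall>P \<phi>. subgroup P S \<and> \<phi> \<in> F P (carrier S) \<longrightarrow>
        gset_isomorphic P X (\<lambda>g. \<theta> (\<phi> g)) X \<theta>)"

text \<open>
  \<open>is_alpha S F P X \<theta>\<close> says that the stable set \<open>X\<close> with action \<open>\<theta>\<close> is (a representative of
  the isomorphism type) \<open>\<alpha>\<^sub>P\<close>; by a theorem of Reeh these are, up to isomorphism, the irreducible
  stable sets of a saturated fusion system.
\<close>

definition is_alpha ::
  "('a, 'b) monoid_scheme \<Rightarrow> ('a set \<Rightarrow> 'a set \<Rightarrow> ('a \<Rightarrow> 'a) set) \<Rightarrow> 'a set
     \<Rightarrow> 'x set \<Rightarrow> ('a \<Rightarrow> 'x \<Rightarrow> 'x) \<Rightarrow> bool" where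
  "is_alpha S F P X \<theta> \<longleftrightarrow> stable_set S F X \<theta> \<and>
     (\<forall>Q. fully_normalized S F Q \<longrightarrow>
        orbit_count S X \<theta> Q = (if fusion_conj F Q P then 1 else 0))"


section \<open>Broken chains\<close>

text \<open>A chain \<open>a\<^sub>0 < \<dots> < a\<^sub>n\<close> is the nonempty list of its terms, so \<open>n\<close> is one less than the list length.\<close>

definition subgroup_chain :: "('a, 'b) monoid_scheme \<Rightarrow> 'a set list \<Rightarrow> bool" where
  "subgroup_chain S \<tau> \<longleftrightarrow> \<tau> \<noteq> [] \<and> (\<forall>P\<in>set \<tau>. subgroup P S) \<and> sorted_wrt (\<subset>) \<tau>"

definition chain_length :: "'a set list \<Rightarrow> nat" where
  "chain_length \<tau> = length \<tau> - 1"

definition tethered_broken_chains ::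
  "('a, 'b) monoid_scheme \<Rightarrow> ('a set \<Rightarrow> 'a set \<Rightarrow> ('a \<Rightarrow> 'a) set) \<Rightarrow> 'a set set
     \<Rightarrow> 'a set \<Rightarrow> 'a set \<Rightarrow> 'a set list list set" where
  "tethered_broken_chains S F \<P> Q P =
     {\<sigma>. (\<forall>\<tau>\<in>set \<sigma>. subgroup_chain S \<tau>)
       \<and> (\<forall>i. Suc i < length \<sigma> \<longrightarrow> fusion_conj F (last (\<sigma> ! i)) (hd (\<sigma> ! Suc i)))
       \<and> (\<forall>\<tau>\<in>set \<sigma>. hd \<tau> \<in> \<P>)
       \<and> (\<forall>\<tau>\<in>set \<sigma>. chain_length \<tau> > 0)
       \<and> (if \<sigma> = [] then fusion_conj F Q P
          else hd (hd \<sigma>) = Q \<and> fusion_conj F (last (last \<sigma>)) P)}"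

definition total_length :: "'a set list list \<Rightarrow> nat" where
  "total_length \<sigma> = length \<sigma> + (\<Sum>\<tau>\<leftarrow>\<sigma>. chain_length \<tau>)"

end

theory Submission
  imports Defs "HOL-Algebra.Zassenhaus"
begin

text \<open>
  Let \<open>e Q\<close> be the number of points of \<open>\<alpha>\<^sub>P\<close> with stabilizer exactly \<open>Q\<close>; it is
  \<open>\<bar>W\<^sub>S Q\<bar>\<close> times the number of orbits isomorphic to \<open>S/Q\<close>. Inverting
  \<open>\<bar>X\<^sup>Q\<bar> = (\<Sum>R\<ge>Q. e R)\<close> by P. Hall's formula for the Moebius function gives \<open>e Q\<close> as the
  signed sum of \<open>\<bar>X\<^sup>R\<bar>\<close> over the chains from \<open>Q\<close> to some \<open>R\<close>. For \<open>Q\<close> in \<open>\<P>\<^sup>*\<close> the left-hand side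
  is \<open>\<bar>W\<^sub>S P\<bar>\<close> or \<open>0\<close>, and by stability each \<open>R\<close> may be replaced by its representative
  in \<open>\<P>\<^sup>*\<close>. Isolating the chain of length \<open>0\<close> leaves a recursion for \<open>\<bar>X\<^sup>Q\<bar>\<close>, which is the one
  obtained for the signed sum over broken chains by removing the first chain.
\<close>

section \<open>Inversion along chains\<close>

text \<open>The last entry is left free. Grouping these chains by it would produce the Moebius
  values of P. Hall's formula; the inversion below only needs the sum over all of them at
  once.\<close>

definition chains_from :: "'c::order set \<Rightarrow> 'c \<Rightarrow> 'c list set" where
  "chains_from A a = {\<tau>. \<tau> \<noteq> [] \<and> hd \<tau> = a \<and> set \<tau> \<subseteq> A \<and> sorted_wrt (<) \<tau>}"

lemma sorted_wrt_less_distinct: "sorted_wrt (<) (\<tau> :: 'c::order list) \<Longrightarrow> distinct \<tau>"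
  by (induction \<tau>) auto

lemma finite_chains_from: "finite A \<Longrightarrow> finite (chains_from A a)"
  by (rule finite_subset[OF _ finite_subset_distinct[of A]])
    (auto simp: chains_from_def sorted_wrt_less_distinct)

lemma chains_from_rec:
  assumes "a \<in> A"
  shows "chains_from A a = insert [a] (\<Union>b\<in>{b \<in> A. a < b}. (#) a ` chains_from A b)"
proof (intro equalityI subsetI)
  fix \<tau> assume "\<tau> \<in> chains_from A a"
  then obtain \<tau>' where \<tau>: "\<tau> = a # \<tau>'" and *: "set \<tau>' \<subseteq> A" "sorted_wrt (<) (a # \<tau>')"
    by (cases \<tau>) (auto simp: chains_from_def)
  show "\<tau> \<in> insert [a] (\<Union>b\<in>{b \<in> A. a < b}. (#) a ` chains_from A b)"
  proof (cases \<tau>')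
    case (Cons b \<rho>)
    then have "\<tau>' \<in> chains_from A b" "b \<in> A" "a < b"
      using * by (auto simp: chains_from_def)
    then show ?thesis using \<tau> by blast
  qed (simp add: \<tau>)
next
  fix \<tau> assume "\<tau> \<in> insert [a] (\<Union>b\<in>{b \<in> A. a < b}. (#) a ` chains_from A b)"
  then consider "\<tau> = [a]" | b \<rho> where "b \<in> A" "a < b" "\<tau> = a # b # \<rho>" "b # \<rho> \<in> chains_from A b"
    by (auto simp: chains_from_def neq_Nil_conv)
  then show "\<tau> \<in> chains_from A a"
    by cases (use assms in \<open>auto simp: chains_from_def intro: less_trans\<close>)
qed

lemma sum_chains_from_rec:
  fixes g :: "'c::order list \<Rightarrow> 'r::comm_monoid_add"
  assumes "finite A" "a \<in> A"
  shows "sum g (chains_from A a) = g [a] + (\<Sum>b | b \<in> A \<and> a < b. \<Sum>\<tau>\<in>chains_from A b. g (a # \<tau>))"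
proof -
  have "sum g (\<Union>b\<in>{b \<in> A. a < b}. (#) a ` chains_from A b)
      = (\<Sum>b | b \<in> A \<and> a < b. \<Sum>\<tau>\<in>(#) a ` chains_from A b. g \<tau>)"
    by (rule sum.UNION_disjoint)
      (simp_all add: assms finite_chains_from, auto simp: chains_from_def)
  also have "\<dots> = (\<Sum>b | b \<in> A \<and> a < b. \<Sum>\<tau>\<in>chains_from A b. g (a # \<tau>))"
    by (simp add: sum.reindex)
  finally have *: "sum g (\<Union>b\<in>{b \<in> A. a < b}. (#) a ` chains_from A b) = \<dots>" .
  have "finite (\<Union>b\<in>{b \<in> A. a < b}. (#) a ` chains_from A b)"
    using assms by (simp add: finite_chains_from)
  moreover have "[a] \<notin> (\<Union>b\<in>{b \<in> A. a < b}. (#) a ` chains_from A b)"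
    by (auto simp: chains_from_def)
  ultimately show ?thesis
    unfolding chains_from_rec[OF \<open>a \<in> A\<close>] by (simp add: *)
qed

text \<open>The chain \<open>[a]\<close> contributes \<open>m a\<close>. A longer chain loses its
  first entry and with it one sign, so by induction those with second entry \<open>b\<close>
  contribute \<open>- e b\<close>; what remains of \<open>m a\<close> is \<open>e a\<close>.\<close>

lemma chain_inversion:
  fixes m e :: "'c::order \<Rightarrow> 'r::comm_ring_1"
  assumes fin: "finite A"
    and m: "\<And>a. a \<in> A \<Longrightarrow> m a = (\<Sum>b | b \<in> A \<and> a \<le> b. e b)"
    and "a \<in> A"
  shows "(\<Sum>\<tau>\<in>chains_from A a. (-1) ^ (length \<tau> - 1) * m (last \<tau>)) = e a"
  using \<open>a \<in> A\<close>
\<comment> \<open>Downward induction in the order: the set of elements above \<open>a\<close>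
  shrinks strictly when \<open>a\<close> is replaced by some \<open>b\<close> above it.\<close>
proof (induction "card {b \<in> A. a < b}" arbitrary: a rule: less_induct)
  case less
  let ?g = "\<lambda>\<tau>. (-1) ^ (length \<tau> - 1) * m (last \<tau>)"
  have "(\<Sum>\<tau>\<in>chains_from A b. ?g (a # \<tau>)) = - e b" if "b \<in> A" "a < b" for b
  proof -
    have "{c \<in> A. b < c} \<subset> {c \<in> A. a < c}"
      using that by (auto intro: less_trans)
    then have IH: "(\<Sum>\<tau>\<in>chains_from A b. ?g \<tau>) = e b"
      using less.hyps[of b] that fin by (simp add: psubset_card_mono)
    have "(\<Sum>\<tau>\<in>chains_from A b. ?g (a # \<tau>)) = (\<Sum>\<tau>\<in>chains_from A b. - ?g \<tau>)"
    proof (rule sum.cong[OF refl])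
      fix \<tau> assume "\<tau> \<in> chains_from A b"
      \<comment> \<open>Nonemptiness matters twice: \<open>length \<tau> - 1\<close> is truncated at
        0, and prepending \<open>a\<close> preserves the last entry only of a nonempty list.\<close>
      then obtain c \<rho> where "\<tau> = c # \<rho>" by (cases \<tau>) (auto simp: chains_from_def)
      then show "?g (a # \<tau>) = - ?g \<tau>" by simp
    qed
    then show ?thesis by (simp only: sum_negf IH)
  qed
  then have "sum ?g (chains_from A a) = m a - (\<Sum>b | b \<in> A \<and> a < b. e b)"
    using sum_chains_from_rec[OF fin less.prems, of ?g] by (simp add: sum_negf)
  also have "{b \<in> A. a \<le> b} = insert a {b \<in> A. a < b}"
    using less.prems by (auto simp: le_less)
  then have "m a = e a + (\<Sum>b | b \<in> A \<and> a < b. e b)"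
    using m[OF less.prems] fin by simp
  finally show ?case by simp
qed


section \<open>Points with a given stabilizer\<close>

text \<open>Lagrange's theorem inside the normalizer, in product form so that no division of
  naturals occurs.\<close>

lemma order_W_grp:
  assumes "group S" "finite (carrier S)" "subgroup Q S"
  shows "order (W_grp S Q) * card Q = card (normalizer S Q)"
proof -
  interpret group S by fact
  interpret N: normal Q "S\<lparr>carrier := normalizer S Q\<rparr>"
    by (rule subgroup_in_normalizer) fact
  have "card (rcosets\<^bsub>S\<lparr>carrier := normalizer S Q\<rparr>\<^esub> Q) * card Q = card (normalizer S Q)"
    using N.lagrange[OF N.subgroup_axioms] by (simp add: order_def)
  then show ?thesis
    by (simp add: W_grp_def FactGroup_def order_def)
qed

context group_action
begin

interpretation grp: group G
  using group_hom by (rule group_hom.axioms)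

lemma stabilizer_image:
  assumes g: "g \<in> carrier G" and x: "x \<in> E"
  shows "stabilizer G \<phi> (\<phi> g x) = g <# stabilizer G \<phi> x #> inv g"
proof (intro equalityI subsetI)
  fix h assume h: "h \<in> stabilizer G \<phi> (\<phi> g x)"
  then have hc: "h \<in> carrier G" and fix_h: "\<phi> h (\<phi> g x) = \<phi> g x"
    by (auto simp: stabilizer_def)
  have "\<phi> (inv g \<otimes> (h \<otimes> g)) x = \<phi> (inv g) (\<phi> g x)"
    using g x hc by (simp add: composition_rule fix_h)
  then have "inv g \<otimes> (h \<otimes> g) \<in> stabilizer G \<phi> x"
    using orbit_sym_aux[OF g x refl] g hc by (simp add: stabilizer_def)
  moreover have "h = g \<otimes> (inv g \<otimes> (h \<otimes> g)) \<otimes> inv g"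
    using g hc by (simp flip: grp.m_assoc) (simp add: grp.m_assoc)
  ultimately show "h \<in> g <# stabilizer G \<phi> x #> inv g"
    unfolding l_coset_def r_coset_def by blast
next
  fix h assume "h \<in> g <# stabilizer G \<phi> x #> inv g"
  then obtain k where k: "k \<in> carrier G" "\<phi> k x = x" and h: "h = g \<otimes> k \<otimes> inv g"
    by (auto simp: l_coset_def r_coset_def stabilizer_def)
  have "\<phi> h (\<phi> g x) = \<phi> (g \<otimes> k) (\<phi> (inv g) (\<phi> g x))"
    using g k x element_image[OF g x refl] by (simp add: h composition_rule)
  also have "\<dots> = \<phi> g x"
    using g k x orbit_sym_aux[OF g x refl] by (simp add: composition_rule)
  finally show "h \<in> stabilizer G \<phi> (\<phi> g x)"
    using g k by (simp add: stabilizer_def h)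
qed

lemma stabilizer_image_eq_iff:
  assumes "g \<in> carrier G" "x \<in> E" "stabilizer G \<phi> x = Q"
  shows "stabilizer G \<phi> (\<phi> g x) = Q \<longleftrightarrow> g \<in> normalizer G Q"
proof -
  \<comment> \<open>\<open>normalizer\<close> is the stabilizer of \<open>Q\<close> for conjugation
    acting on the subsets of the carrier, a restricted function; the inclusion lets it be evaluated
    at \<open>Q\<close>.\<close>
  have "Q \<subseteq> carrier G" using assms(3) stabilizer_subset by blast
  then have "g \<in> normalizer G Q \<longleftrightarrow> g <# Q #> inv g = Q"
    using assms(1) by (simp add: normalizer_def stabilizer_def)
  then show ?thesis
    by (simp add: stabilizer_image[OF assms(1,2)] assms(3))
qed

text \<open>The points in question form a single orbit of the normalizer of \<open>Q\<close>, and
  the stabilizer of \<open>x\<close> there is still \<open>Q\<close>. Orbit-stabilizer for the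
  normalizer then gives its index over \<open>Q\<close>.\<close>

lemma card_stabilizer_eq_in_orbit:
  assumes fin: "finite (carrier G)" and x: "x \<in> E" and stab: "stabilizer G \<phi> x = Q"
  shows "card {y \<in> orbit G \<phi> x. stabilizer G \<phi> y = Q} = order (W_grp G Q)"
proof -
  have Q: "subgroup Q G" using stabilizer_subgroup[OF x] stab by simp
  let ?N = "G\<lparr>carrier := normalizer G Q\<rparr>"
  have N: "subgroup (normalizer G Q) G"
    by (rule grp.normalizer_imp_subgroup) (rule subgroup.subset[OF Q])
  interpret NA: group_action ?N E \<phi> by (rule induced_action[OF N])
  have "Q \<subseteq> normalizer G Q"
    using normal_imp_subgroup[OF grp.subgroup_in_normalizer[OF Q]] subgroup.subset by force
  then have "stabilizer ?N \<phi> x = Q"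
    using stab subgroup.subset[OF N] by (auto simp: stabilizer_def)
  moreover have "orbit ?N \<phi> x = {y \<in> orbit G \<phi> x. stabilizer G \<phi> y = Q}"
    using stabilizer_image_eq_iff[OF _ x stab] subgroup.subset[OF N] by (auto simp: orbit_def)
  ultimately have "card {y \<in> orbit G \<phi> x. stabilizer G \<phi> y = Q} * card Q = card (normalizer G Q)"
    using NA.orbit_stabilizer_theorem[OF x] by (simp add: order_def)
  moreover have "card Q > 0"
    using subgroup.subset[OF Q] subgroup.one_closed[OF Q] fin
    by (auto simp: card_gt_0_iff dest: finite_subset)
  ultimately show ?thesis
    using order_W_grp[OF grp.group_axioms fin Q] by (metis mult_cancel2 less_numeral_extra(3))
qed

text \<open>An isomorphism preserves stabilizers, and the trivial coset has stabilizer
  \<open>Q\<close>. Conversely, a point with stabilizer \<open>Q\<close> serves as base point for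
  identifying the orbit with the cosets.\<close>

lemma orbit_isomorphic_iff:
  assumes Q: "subgroup Q G" and x: "x \<in> E"
  shows "gset_isomorphic (carrier G) (orbit G \<phi> x) \<phi> (lcosets Q) (\<lambda>g C. g <# C)
    \<longleftrightarrow> (\<exists>y\<in>orbit G \<phi> x. stabilizer G \<phi> y = Q)"
proof
  assume "gset_isomorphic (carrier G) (orbit G \<phi> x) \<phi> (lcosets Q) (\<lambda>g C. g <# C)"
  then obtain f where f: "bij_betw f (orbit G \<phi> x) (lcosets Q)"
    and eq: "\<And>h y. h \<in> carrier G \<Longrightarrow> y \<in> orbit G \<phi> x \<Longrightarrow> f (\<phi> h y) = h <# f y"
    unfolding gset_isomorphic_def by blast
  have "Q \<in> lcosets Q"
    using grp.lcos_mult_one[OF subgroup.subset[OF Q]] by (auto simp: LCOSETS_def)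
  then obtain y where y: "y \<in> orbit G \<phi> x" "f y = Q"
    using f by (metis bij_betw_iff_bijections)
  have "\<phi> g y = y \<longleftrightarrow> g \<in> Q" if g: "g \<in> carrier G" for g
  proof -
    have "\<phi> g y \<in> orbit G \<phi> x"
      using y(1) g x by (auto simp: orbit_def simp flip: composition_rule)
    then have "\<phi> g y = y \<longleftrightarrow> g <# Q = Q"
      using f eq[OF g y(1)] y by (metis bij_betw_imp_inj_on inj_onD)
    also have "\<dots> \<longleftrightarrow> g \<in> Q"
      using grp.lcos_self[OF g Q] grp.coset_join3[OF g Q] by auto
    finally show ?thesis .
  qed
  then have "stabilizer G \<phi> y = Q"
    using subgroup.subset[OF Q] by (auto simp: stabilizer_def)
  then show "\<exists>y\<in>orbit G \<phi> x. stabilizer G \<phi> y = Q" using y by blast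
next
  assume "\<exists>y\<in>orbit G \<phi> x. stabilizer G \<phi> y = Q"
  then obtain y where y: "y \<in> orbit G \<phi> x" and stab: "stabilizer G \<phi> y = Q" by blast
  have yE: "y \<in> E" using y x element_image by (auto simp: orbit_def)
  have orb: "orbit G \<phi> x = orbit G \<phi> y"
    using disjoint_union[of "orbit G \<phi> x" "orbit G \<phi> y"] orbit_refl[OF yE] x y yE
    by (auto simp: orbits_def)
  \<comment> \<open>The set of all elements carrying \<open>y\<close> to \<open>z\<close>. It turns
    out to be a left coset of \<open>Q\<close>, so no representative has to be chosen.\<close>
  define f where "f z = {h \<in> carrier G. \<phi> h y = z}" for z
  have f: "f (\<phi> g y) = g <# Q" if g: "g \<in> carrier G" for g
  proof (intro equalityI subsetI)
    fix h assume "h \<in> f (\<phi> g y)"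
    then have h: "h \<in> carrier G" "\<phi> h y = \<phi> g y" by (auto simp: f_def)
    then have "inv g \<otimes> h \<in> Q"
      using g yE orbit_sym_aux[OF g yE refl] by (simp add: stab[symmetric] stabilizer_def composition_rule)
    moreover have "h = g \<otimes> (inv g \<otimes> h)"
      using g h(1) by (simp flip: grp.m_assoc)
    ultimately show "h \<in> g <# Q" unfolding l_coset_def by blast
  next
    fix h assume "h \<in> g <# Q"
    then show "h \<in> f (\<phi> g y)"
      using g yE by (auto simp: f_def l_coset_def stab[symmetric] stabilizer_def composition_rule)
  qed
  have "f (\<phi> h z) = h <# f z" if h: "h \<in> carrier G" and z: "z \<in> orbit G \<phi> x" for h z
  proof -
    obtain g where g: "g \<in> carrier G" "z = \<phi> g y"
      using z unfolding orb by (auto simp: orbit_def)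
    have "f (\<phi> h z) = f (\<phi> (h \<otimes> g) y)"
      using g h yE by (simp add: composition_rule)
    also have "\<dots> = h <# (g <# Q)"
      using g h subgroup.subset[OF Q] by (simp add: f grp.lcos_m_assoc)
    finally show ?thesis using g by (simp add: f)
  qed
  moreover have "bij_betw f (orbit G \<phi> x) (lcosets Q)"
  proof (intro bij_betw_imageI inj_onI)
    fix z z' assume "z \<in> orbit G \<phi> x" "z' \<in> orbit G \<phi> x" "f z = f z'"
    then show "z = z'" unfolding orb by (auto simp: f_def orbit_def)
  next
    show "f ` orbit G \<phi> x = lcosets Q"
      unfolding orb by (force simp: orbit_def LCOSETS_def f)
  qed
  ultimately show "gset_isomorphic (carrier G) (orbit G \<phi> x) \<phi> (lcosets Q) (\<lambda>g C. g <# C)"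
    unfolding gset_isomorphic_def by blast
qed

text \<open>Counting orbit by orbit: an orbit isomorphic to the cosets of \<open>Q\<close> contains
  \<open>order (W_grp G Q)\<close> such points, any other orbit none.\<close>

lemma card_stabilizer_eq:
  assumes fin: "finite (carrier G)" "finite E" and Q: "subgroup Q G"
  shows "card {x \<in> E. stabilizer G \<phi> x = Q} = orbit_count G E \<phi> Q * order (W_grp G Q)"
proof -
  let ?w = "order (W_grp G Q)"
  let ?iso = "\<lambda>Y. gset_isomorphic (carrier G) Y \<phi> (lcosets Q) (\<lambda>g C. g <# C)"
  have finO: "finite (orbits G E \<phi>)" using fin by (simp add: orbits_def)
  have sub: "Y \<subseteq> E" if "Y \<in> orbits G E \<phi>" for Y
    using orbits_coverture that by blast
  have Y: "card {x \<in> Y. stabilizer G \<phi> x = Q} = (if ?iso Y then ?w else 0)"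
    if YO: "Y \<in> orbits G E \<phi>" for Y
  proof (cases "\<exists>y\<in>Y. stabilizer G \<phi> y = Q")
    case True
    then obtain y where y: "y \<in> Y" "stabilizer G \<phi> y = Q" by blast
    then have yE: "y \<in> E" using sub[OF YO] by blast
    then have "Y = orbit G \<phi> y"
      using disjoint_union[OF YO, of "orbit G \<phi> y"] orbit_refl[OF yE] y by (auto simp: orbits_def)
    then show ?thesis
      using card_stabilizer_eq_in_orbit[OF fin(1) yE y(2)] orbit_isomorphic_iff[OF Q yE] True by simp
  next
    case False
    then have "{x \<in> Y. stabilizer G \<phi> x = Q} = {}" by blast
    moreover have "\<not> ?iso Y"
      using False YO orbit_isomorphic_iff[OF Q] by (auto simp: orbits_def)
    ultimately show ?thesis by (simp only: card.empty if_False)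
  qed
  have "card {x \<in> E. stabilizer G \<phi> x = Q} = (\<Sum>x\<in>E. if stabilizer G \<phi> x = Q then 1 else 0)"
    using fin by (intro card_as_sums) auto
  also have "\<dots> = (\<Sum>Y\<in>orbits G E \<phi>. \<Sum>x\<in>Y. if stabilizer G \<phi> x = Q then 1 else 0)"
    by (rule disjoint_sum[OF fin(2), symmetric])
  also have "\<dots> = (\<Sum>Y\<in>orbits G E \<phi>. if ?iso Y then ?w else 0)"
  proof (rule sum.cong[OF refl])
    fix Y assume "Y \<in> orbits G E \<phi>"
    then show "(\<Sum>x\<in>Y. if stabilizer G \<phi> x = Q then 1 else 0) = (if ?iso Y then ?w else 0)"
      using Y finite_subset[OF sub fin(2)] by (subst card_as_sums[symmetric, OF refl]) auto
  qed
  also have "\<dots> = orbit_count G E \<phi> Q * ?w"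
    using finO by (simp add: sum.If_cases orbit_count_def Int_def)
  finally show ?thesis .
qed

lemma fixed_points_eq:
  assumes "Q \<subseteq> carrier G"
  shows "fixed_points E \<phi> Q = {x \<in> E. Q \<subseteq> stabilizer G \<phi> x}"
  using assms by (auto simp: fixed_points_def stabilizer_def)

text \<open>A point is fixed by \<open>Q\<close> exactly when its stabilizer contains
  \<open>Q\<close>, so the fixed points split according to their stabilizer. The index set has the
  shape required by \<open>chain_inversion\<close>.\<close>

lemma card_fixed_points_eq_sum:
  assumes fin: "finite (carrier G)" "finite E" and Q: "subgroup Q G"
  shows "card (fixed_points E \<phi> Q)
    = (\<Sum>R | R \<in> {R. subgroup R G} \<and> Q \<subseteq> R. card {x \<in> E. stabilizer G \<phi> x = R})"
proof -
  have "fixed_points E \<phi> Q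
      = (\<Union>R\<in>{R. subgroup R G \<and> Q \<subseteq> R}. {x \<in> E. stabilizer G \<phi> x = R})"
    using stabilizer_subgroup by (auto simp: fixed_points_eq[OF subgroup.subset[OF Q]])
  moreover have "finite {R. subgroup R G \<and> Q \<subseteq> R}"
    by (rule finite_subset[of _ "Pow (carrier G)"]) (use fin subgroup.subset in auto)
  ultimately show ?thesis
    using fin by (simp add: card_UN_disjoint disjoint_iff)
qed

end


section \<open>Fusion systems\<close>

context fusion_system
begin

lemma finite_carrier: "finite (carrier S)"
  using order_power prime_p by (auto simp: order_def card_gt_0_iff prime_gt_0_nat intro: card_ge_0_finite)

lemma fusion_conj_refl:
  assumes "subgroup P S"
  shows "fusion_conj F P P"
proof -
  have eq: "conj_map S P \<one> = (\<lambda>x\<in>P. x)"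
    using subgroup.mem_carrier[OF assms] by (auto simp: conj_map_def)
  then have "(\<lambda>x\<in>P. x) \<in> Hom_grp S P P"
    unfolding Hom_grp_def by (auto intro!: exI[of _ "\<one>"])
  then have "(\<lambda>x\<in>P. x) \<in> F P P" using Hom_grp_subset assms by blast
  then have "(\<lambda>x\<in>P. x) \<in> fusion_iso F P P"
    by (auto simp: fusion_iso_def compose_def restrict_def fun_eq_iff intro!: bexI[of _ "\<lambda>x\<in>P. x"])
  then show ?thesis by (auto simp: fusion_conj_def)
qed

lemma fusion_conj_sym: "fusion_conj F P Q \<Longrightarrow> fusion_conj F Q P"
  unfolding fusion_conj_def fusion_iso_def by blast

lemma morphism_funcset:
  "\<lbrakk>subgroup P S; subgroup Q S; \<phi> \<in> F P Q\<rbrakk> \<Longrightarrow> \<phi> \<in> P \<rightarrow> Q"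
  using subset_Inj_grp by (fastforce simp: Inj_grp_def hom_def)

text \<open>Turns equations between extensional composites into pointwise inverse laws, which are
  easier to use below.\<close>

lemma fusion_isoE:
  assumes "fusion_conj F P Q" "subgroup P S" "subgroup Q S"
  obtains \<phi> \<psi> where "\<phi> \<in> F P Q" "\<psi> \<in> F Q P" "\<phi> \<in> P \<rightarrow> Q" "\<psi> \<in> Q \<rightarrow> P"
    "\<And>x. x \<in> P \<Longrightarrow> \<psi> (\<phi> x) = x" "\<And>y. y \<in> Q \<Longrightarrow> \<phi> (\<psi> y) = y"
proof -
  obtain \<phi> \<psi> where *: "\<phi> \<in> F P Q" "\<psi> \<in> F Q P"
    "compose P \<psi> \<phi> = (\<lambda>x\<in>P. x)" "compose Q \<phi> \<psi> = (\<lambda>x\<in>Q. x)"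
    using assms(1) unfolding fusion_conj_def fusion_iso_def by blast
  show thesis
  proof (rule that[OF *(1,2)])
    show "\<phi> \<in> P \<rightarrow> Q" "\<psi> \<in> Q \<rightarrow> P" using * assms morphism_funcset by blast+
    show "\<psi> (\<phi> x) = x" if "x \<in> P" for x
      using fun_cong[OF *(3), of x] that by (simp add: compose_eq)
    show "\<phi> (\<psi> y) = y" if "y \<in> Q" for y
      using fun_cong[OF *(4), of y] that by (simp add: compose_eq)
  qed
qed

lemma fusion_conj_trans:
  assumes "fusion_conj F P Q" "fusion_conj F Q R" "subgroup P S" "subgroup Q S" "subgroup R S"
  shows "fusion_conj F P R"
proof -
  obtain \<phi> \<psi> where 1: "\<phi> \<in> F P Q" "\<psi> \<in> F Q P" "\<phi> \<in> P \<rightarrow> Q" "\<psi> \<in> Q \<rightarrow> P"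
    "\<And>x. x \<in> P \<Longrightarrow> \<psi> (\<phi> x) = x" "\<And>y. y \<in> Q \<Longrightarrow> \<phi> (\<psi> y) = y"
    using fusion_isoE[OF assms(1,3,4)] by metis
  obtain \<phi>' \<psi>' where 2: "\<phi>' \<in> F Q R" "\<psi>' \<in> F R Q" "\<phi>' \<in> Q \<rightarrow> R" "\<psi>' \<in> R \<rightarrow> Q"
    "\<And>x. x \<in> Q \<Longrightarrow> \<psi>' (\<phi>' x) = x" "\<And>y. y \<in> R \<Longrightarrow> \<phi>' (\<psi>' y) = y"
    using fusion_isoE[OF assms(2,4,5)] by metis
  have "compose P (compose R \<psi> \<psi>') (compose P \<phi>' \<phi>) = (\<lambda>x\<in>P. x)"
    using 1 2 by (auto simp: compose_def restrict_def fun_eq_iff Pi_iff)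
  moreover have "compose R (compose P \<phi>' \<phi>) (compose R \<psi> \<psi>') = (\<lambda>x\<in>R. x)"
    using 1 2 by (auto simp: compose_def restrict_def fun_eq_iff Pi_iff)
  ultimately have "compose P \<phi>' \<phi> \<in> fusion_iso F P R"
    using comp_closed[of P Q R \<phi> \<phi>'] comp_closed[of R Q P \<psi>' \<psi>] 1 2 assms
    unfolding fusion_iso_def by blast
  then show ?thesis by (auto simp: fusion_conj_def)
qed

text \<open>Makes the order of a subgroup an invariant of its class, so that inductions on it
  survive the passage to representatives.\<close>

lemma fusion_conj_card_eq:
  assumes "fusion_conj F P Q" "subgroup P S" "subgroup Q S"
  shows "card P = card Q"
proof -
  obtain \<phi> \<psi> where "\<phi> \<in> P \<rightarrow> Q" "\<psi> \<in> Q \<rightarrow> P"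
    "\<And>x. x \<in> P \<Longrightarrow> \<psi> (\<phi> x) = x" "\<And>y. y \<in> Q \<Longrightarrow> \<phi> (\<psi> y) = y"
    using fusion_isoE[OF assms] by metis
  then show ?thesis
    by (intro bij_betw_same_card[of \<phi>] bij_betw_byWitness[of _ \<psi>]) auto
qed

text \<open>Stability is tested on morphisms into all of \<open>S\<close>. Composing with the
  inclusion, which is conjugation by \<open>\<one>\<close>, changes the target but not the
  extensional function.\<close>

lemma morphism_into_carrier:
  assumes "subgroup P S" "subgroup Q S" "\<phi> \<in> F P Q"
  shows "\<phi> \<in> F P (carrier S)"
proof -
  have Q: "Q \<subseteq> carrier S" using assms by (simp add: subgroup.subset)
  then have eq: "conj_map S Q \<one> = (\<lambda>x\<in>Q. x)"
    by (auto simp: conj_map_def subset_iff)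
  have "conj_map S Q \<one> \<in> Hom_grp S Q (carrier S)"
    unfolding Hom_grp_def using Q eq by (auto intro!: exI[of _ "\<one>"])
  then have "(\<lambda>x\<in>Q. x) \<in> F Q (carrier S)"
    using Hom_grp_subset[OF assms(2) subgroup_self] eq by auto
  then have "compose P (\<lambda>x\<in>Q. x) \<phi> \<in> F P (carrier S)"
    using comp_closed[OF assms(1,2) subgroup_self assms(3)] by blast
  moreover have "compose P (\<lambda>x\<in>Q. x) \<phi> = \<phi>"
    using subset_Inj_grp[OF assms(1,2)] assms(3) morphism_funcset[OF assms]
    by (auto simp: Inj_grp_def compose_def restrict_def fun_eq_iff extensional_def Pi_iff)
  ultimately show ?thesis by simp
qed

text \<open>Stability yields a bijection \<open>f\<close> from \<open>X\<close> twisted along \<phi>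
  to \<open>X\<close>. Since \<phi> maps \<open>P\<close> onto \<open>Q\<close>, the points fixed by
  \<open>P\<close> in the twisted action are those fixed by \<open>Q\<close>, and \<open>f\<close>
  carries them to the fixed points of \<open>P\<close>.\<close>

lemma stable_set_card_fixed_points:
  assumes "stable_set S F X \<theta>" "fusion_conj F P Q" "subgroup P S" "subgroup Q S"
  shows "card (fixed_points X \<theta> P) = card (fixed_points X \<theta> Q)"
proof -
  obtain \<phi> \<psi> where \<phi>: "\<phi> \<in> F P Q" "\<phi> \<in> P \<rightarrow> Q" "\<psi> \<in> Q \<rightarrow> P" "\<And>y. y \<in> Q \<Longrightarrow> \<phi> (\<psi> y) = y"
    using fusion_isoE[OF assms(2-4)] by metis
  then have "gset_isomorphic P X (\<lambda>g. \<theta> (\<phi> g)) X \<theta>"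
    using assms morphism_into_carrier by (simp add: stable_set_def)
  then obtain f where f: "bij_betw f X X" "\<And>h x. h \<in> P \<Longrightarrow> x \<in> X \<Longrightarrow> f (\<theta> (\<phi> h) x) = \<theta> h (f x)"
    unfolding gset_isomorphic_def by blast
  interpret group_action S X \<theta> using assms(1) by (simp add: stable_set_def)
  have iff: "\<theta> h (f x) = f x \<longleftrightarrow> \<theta> (\<phi> h) x = x" if "h \<in> P" "x \<in> X" for h x
  proof -
    have "\<phi> h \<in> carrier S" using that \<phi>(2) subgroup.subset[OF assms(4)] by blast
    then have "\<theta> (\<phi> h) x \<in> X" using element_image that by blast
    then show ?thesis using f that by (metis bij_betw_imp_inj_on inj_onD)
  qed
  have im: "\<phi> ` P = Q" using \<phi>(2-4) by (force simp: image_iff)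
  have Q: "fixed_points X \<theta> Q = {x \<in> X. \<forall>h\<in>P. \<theta> (\<phi> h) x = x}"
    by (force simp: fixed_points_def simp flip: im)
  have "f ` fixed_points X \<theta> Q = fixed_points X \<theta> P"
  proof (intro equalityI subsetI)
    fix y assume y: "y \<in> fixed_points X \<theta> P"
    then obtain x where "x \<in> X" "y = f x"
      using f(1) by (auto simp: fixed_points_def bij_betw_def)
    then show "y \<in> f ` fixed_points X \<theta> Q"
      using y iff unfolding Q by (auto simp: fixed_points_def)
  next
    fix y assume "y \<in> f ` fixed_points X \<theta> Q"
    then show "y \<in> fixed_points X \<theta> P"
      using f(1) iff unfolding Q by (auto simp: fixed_points_def bij_betw_def)
  qed
  moreover have "inj_on f (fixed_points X \<theta> Q)"
    using f(1) by (auto simp: bij_betw_def fixed_points_def intro: inj_on_subset)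
  ultimately show ?thesis using card_image by fastforce
qed

end


section \<open>Recursion for broken chains\<close>

abbreviation subgroups :: "('a, 'b) monoid_scheme \<Rightarrow> 'a set set" where
  "subgroups S \<equiv> {P. subgroup P S}"

lemma subgroup_chain_iff:
  "subgroup_chain S \<tau> \<and> hd \<tau> = Q \<longleftrightarrow> \<tau> \<in> chains_from (subgroups S) Q"
  by (auto simp: subgroup_chain_def chains_from_def)

text \<open>Stating the linking condition by \<open>successively\<close> instead of indices lets it
  simplify when a chain is put in front.\<close>

lemma tethered_broken_chains_iff:
  "\<sigma> \<in> tethered_broken_chains S F \<P> Q P \<longleftrightarrow>
    (\<forall>\<tau>\<in>set \<sigma>. subgroup_chain S \<tau> \<and> hd \<tau> \<in> \<P> \<and> chain_length \<tau> > 0) \<and>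
    successively (\<lambda>\<tau> \<tau>'. fusion_conj F (last \<tau>) (hd \<tau>')) \<sigma> \<and>
    (if \<sigma> = [] then fusion_conj F Q P
     else hd (hd \<sigma>) = Q \<and> fusion_conj F (last (last \<sigma>)) P)"
  unfolding tethered_broken_chains_def successively_conv_nth by blast

lemma total_length_simps [simp]:
  "total_length [] = 0"
  "total_length (\<tau> # \<sigma>) = Suc (chain_length \<tau> + total_length \<sigma>)"
  by (simp_all add: total_length_def)

section \<open>Class representatives and removal of the first chain\<close>

locale fusion_system_reps = fusion_system +
  fixes \<P> :: "'a set set"
  assumes reps: "conj_class_reps S F \<P>"
begin

definition rep :: "'a set \<Rightarrow> 'a set" where
  "rep P = (THE Q. Q \<in> \<P> \<and> fusion_conj F Q P)"

lemma reps_subgroup: "P \<in> \<P> \<Longrightarrow> subgroup P S"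
  using reps by (simp add: conj_class_reps_def)

lemma
  assumes "subgroup P S"
  shows rep_mem: "rep P \<in> \<P>" and rep_conj: "fusion_conj F (rep P) P"
    and rep_unique: "\<lbrakk>Q \<in> \<P>; fusion_conj F Q P\<rbrakk> \<Longrightarrow> Q = rep P"
proof -
  have "\<exists>!Q. Q \<in> \<P> \<and> fusion_conj F Q P"
    using reps assms by (auto simp: conj_class_reps_def)
  from theI'[OF this] this show "rep P \<in> \<P>" "fusion_conj F (rep P) P"
    "\<lbrakk>Q \<in> \<P>; fusion_conj F Q P\<rbrakk> \<Longrightarrow> Q = rep P"
    unfolding rep_def by blast+
qed

lemma fusion_conj_rep_iff:
  assumes "subgroup R S" "subgroup P S"
  shows "fusion_conj F (rep R) P \<longleftrightarrow> fusion_conj F R P"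
  using assms rep_conj[OF assms(1)] reps_subgroup[OF rep_mem[OF assms(1)]]
    fusion_conj_sym fusion_conj_trans by metis

text \<open>For \<open>Q\<close> in \<open>\<P>\<close> these are the possible first chains of a
  nonempty broken chain; only \<open>[Q]\<close> is left out.\<close>

abbreviation long_chains :: "'a set \<Rightarrow> 'a set list set" where
  "long_chains Q \<equiv> {\<tau> \<in> chains_from (subgroups S) Q. chain_length \<tau> > 0}"

lemma long_chains_last:
  assumes "\<tau> \<in> long_chains Q"
  shows "subgroup (last \<tau>) S" "Q \<subset> last \<tau>"
proof -
  obtain R \<rho> where "\<tau> = Q # R # \<rho>"
    using assms by (cases \<tau>; cases "tl \<tau>") (auto simp: chains_from_def chain_length_def)
  then show "subgroup (last \<tau>) S" "Q \<subset> last \<tau>"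
    using assms last_in_set[of "R # \<rho>"] by (auto simp: chains_from_def)
qed

lemma finite_subgroups: "finite (subgroups S)"
  by (rule finite_subset[of _ "Pow (carrier S)"]) (use finite_carrier subgroup.subset in auto)

lemma finite_long_chains: "finite (long_chains Q)"
  using finite_chains_from[OF finite_subgroups] by simp

text \<open>Justifies induction on \<open>order S - card Q\<close>: the order grows strictly along a
  chain and is unchanged by passing to the representative. The upper bound ensures that the
  truncated difference really drops.\<close>

lemma card_rep_last:
  assumes "\<tau> \<in> long_chains Q"
  shows "card Q < card (rep (last \<tau>))" "card (rep (last \<tau>)) \<le> order S"
proof -
  note last = long_chains_last[OF assms]
  have "card (rep (last \<tau>)) = card (last \<tau>)"
    using fusion_conj_card_eq[OF rep_conj] last(1) reps_subgroup rep_mem by blast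
  moreover have "finite (last \<tau>)" "last \<tau> \<subseteq> carrier S"
    using last(1) finite_carrier subgroup.subset finite_subset by metis+
  ultimately show "card Q < card (rep (last \<tau>))" "card (rep (last \<tau>)) \<le> order S"
    using last(2) finite_carrier by (simp_all add: psubset_card_mono card_mono order_def)
qed

text \<open>The chain after \<tau> has to start at a member of \<open>\<P>\<close> conjugate to
  \<open>last \<tau>\<close>, hence at \<open>rep (last \<tau>)\<close>. If nothing follows, the end
  condition passes from \<open>last \<tau>\<close> to its representative.\<close>

lemma broken_chains_Cons_iff:
  assumes "Q \<in> \<P>" "subgroup P S"
  shows "\<tau> # \<sigma> \<in> tethered_broken_chains S F \<P> Q P \<longleftrightarrow>
    \<tau> \<in> long_chains Q \<and> \<sigma> \<in> tethered_broken_chains S F \<P> (rep (last \<tau>)) P"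
proof (cases "\<tau> \<in> long_chains Q")
  case False
  then show ?thesis
    using subgroup_chain_iff[of S \<tau> Q] by (auto simp: tethered_broken_chains_iff)
next
  case True
  then have \<tau>: "subgroup_chain S \<tau>" "hd \<tau> = Q" "chain_length \<tau> > 0"
    using subgroup_chain_iff[of S \<tau> Q] by auto
  have last: "subgroup (last \<tau>) S" using long_chains_last True by blast
  show ?thesis
  proof (cases \<sigma>)
    case Nil
    show ?thesis
      using True \<tau> assms fusion_conj_rep_iff[OF last]
      by (simp add: Nil tethered_broken_chains_iff)
  next
    case (Cons \<tau>' \<sigma>')
    have "hd \<tau>' \<in> \<P> \<Longrightarrow> fusion_conj F (last \<tau>) (hd \<tau>') \<longleftrightarrow> hd \<tau>' = rep (last \<tau>)"
      using rep_unique[OF last, of "hd \<tau>'"] fusion_conj_sym[OF rep_conj[OF last]]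
        fusion_conj_sym[of "last \<tau>" "hd \<tau>'"] by auto
    then show ?thesis
      using True \<tau> assms(1)
      by (cases "hd \<tau>' \<in> \<P>") (simp_all add: Cons tethered_broken_chains_iff conj_ac)
  qed
qed

lemma broken_chains_rec:
  assumes "Q \<in> \<P>" "subgroup P S"
  shows "tethered_broken_chains S F \<P> Q P = (if fusion_conj F Q P then {[]} else {}) \<union>
    (\<Union>\<tau>\<in>long_chains Q. (#) \<tau> ` tethered_broken_chains S F \<P> (rep (last \<tau>)) P)"
    (is "?L = ?R")
proof (rule Set.set_eqI)
  fix \<sigma> show "\<sigma> \<in> ?L \<longleftrightarrow> \<sigma> \<in> ?R"
  proof (cases \<sigma>)
    case Nil
    then show ?thesis by (auto simp: tethered_broken_chains_iff)
  next
    case (Cons \<tau> \<sigma>')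
    then show ?thesis by (auto simp: broken_chains_Cons_iff[OF assms])
  qed
qed

text \<open>Each further chain starts at a representative of strictly larger order. Finiteness keeps
  the signed sum from taking the default value 0 of sums over infinite sets.\<close>

lemma finite_broken_chains:
  assumes "Q \<in> \<P>" "subgroup P S"
  shows "finite (tethered_broken_chains S F \<P> Q P)"
  using assms(1)
proof (induction "order S - card Q" arbitrary: Q rule: less_induct)
  case less
  have "finite (tethered_broken_chains S F \<P> (rep (last \<tau>)) P)" if "\<tau> \<in> long_chains Q" for \<tau>
    using less.hyps card_rep_last[OF that] rep_mem long_chains_last(1)[OF that] by simp
  then show ?case
    unfolding broken_chains_rec[OF less.prems assms(2)] using finite_long_chains by simp
qed

section \<open>Signed counts and fixed points satisfy the same recursion\<close>

definition signed_count :: "'a set \<Rightarrow> 'a set \<Rightarrow> int" where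
  "signed_count Q P = (\<Sum>\<sigma>\<in>tethered_broken_chains S F \<P> Q P. (-1) ^ total_length \<sigma>)"

text \<open>Prepending \<tau> raises the total length by \<open>chain_length \<tau>\<close> plus one
  for the additional chain; that one is the source of the minus sign.\<close>

lemma signed_count_rec:
  assumes "Q \<in> \<P>" "subgroup P S"
  shows "signed_count Q P = (if fusion_conj F Q P then 1 else 0) -
    (\<Sum>\<tau>\<in>long_chains Q. (-1) ^ chain_length \<tau> * signed_count (rep (last \<tau>)) P)"
proof -
  let ?T = "\<lambda>\<tau>. tethered_broken_chains S F \<P> (rep (last \<tau>)) P"
  let ?g = "\<lambda>\<sigma> :: 'a set list list. (-1) ^ total_length \<sigma> :: int"
  have fin: "finite (?T \<tau>)" if "\<tau> \<in> long_chains Q" for \<tau>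
    using finite_broken_chains assms(2) rep_mem long_chains_last(1)[OF that] by blast
  have "signed_count Q P = sum ?g (if fusion_conj F Q P then {[]} else {})
      + sum ?g (\<Union>\<tau>\<in>long_chains Q. (#) \<tau> ` ?T \<tau>)"
    unfolding signed_count_def broken_chains_rec[OF assms]
    by (rule sum.union_disjoint) (use fin finite_long_chains in auto)
  also have "sum ?g (\<Union>\<tau>\<in>long_chains Q. (#) \<tau> ` ?T \<tau>)
      = (\<Sum>\<tau>\<in>long_chains Q. sum ?g ((#) \<tau> ` ?T \<tau>))"
    by (rule sum.UNION_disjoint) (use fin finite_long_chains in auto)
  also have "\<dots> = (\<Sum>\<tau>\<in>long_chains Q. - ((-1) ^ chain_length \<tau> * signed_count (rep (last \<tau>)) P))"
    by (intro sum.cong refl)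
      (simp add: sum.reindex power_add signed_count_def sum_distrib_left sum_negf)
  finally show ?thesis by (simp add: sum_negf)
qed

text \<open>Valid for every stable set: \<open>chain_inversion\<close> at \<open>Q\<close>, solved
  for the term of the chain \<open>[Q]\<close>. Only the orbit count distinguishes one stable set
  from another here.\<close>

lemma card_fixed_points_rec:
  assumes stable: "stable_set S F X \<theta>" and Q: "subgroup Q S"
  shows "int (card (fixed_points X \<theta> Q)) = int (orbit_count S X \<theta> Q * order (W_grp S Q)) -
    (\<Sum>\<tau>\<in>long_chains Q. (-1) ^ chain_length \<tau> * int (card (fixed_points X \<theta> (rep (last \<tau>)))))"
proof -
  interpret group_action S X \<theta> using stable by (simp add: stable_set_def)
  have fin: "finite X" using stable by (simp add: stable_set_def)
  let ?m = "\<lambda>R. int (card (fixed_points X \<theta> R))"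
  let ?g = "\<lambda>\<tau>. (-1) ^ chain_length \<tau> * ?m (last \<tau>)"
  have chains: "chains_from (subgroups S) Q = insert [Q] (long_chains Q)"
    using Q by (auto simp: chains_from_def chain_length_def length_Suc_conv neq_Nil_conv)
  have "[Q] \<notin> long_chains Q" by (simp add: chain_length_def)
  \<comment> \<open>Putting \<open>[Q]\<close> back completes the long chains to all chains from
    \<open>Q\<close>; it has length 0 and hence sign \<open>+1\<close>.\<close>
  from sum.insert[OF finite_long_chains this, of ?g, folded chains]
  have "?m Q + sum ?g (long_chains Q) = sum ?g (chains_from (subgroups S) Q)"
    by (simp add: chain_length_def)
  also have "\<dots> = int (card {x \<in> X. stabilizer S \<theta> x = Q})"
    unfolding chain_length_def
    by (rule chain_inversion[OF finite_subgroups])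
      (use card_fixed_points_eq_sum[OF finite_carrier fin] Q in auto)
  also have "\<dots> = int (orbit_count S X \<theta> Q * order (W_grp S Q))"
    by (simp add: card_stabilizer_eq[OF finite_carrier fin Q])
  also have "sum ?g (long_chains Q)
      = (\<Sum>\<tau>\<in>long_chains Q. (-1) ^ chain_length \<tau> * ?m (rep (last \<tau>)))"
  \<comment> \<open>Stability enters here: fixed-point numbers are constant on conjugacy
    classes.\<close>
  proof (rule sum.cong[OF refl])
    fix \<tau> assume "\<tau> \<in> long_chains Q"
    then have "subgroup (last \<tau>) S" by (rule long_chains_last)
    then show "?g \<tau> = (-1) ^ chain_length \<tau> * ?m (rep (last \<tau>))"
      using stable_set_card_fixed_points[OF stable rep_conj] rep_mem reps_subgroup by simp
  qed
  finally show ?thesis by simp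
qed

text \<open>Induction from large subgroups to small ones through the two recursions. Their leading
  terms match because members of \<open>\<P>\<close> are fully normalized, so that
  \<open>is_alpha\<close> prescribes the orbit count at \<open>Q\<close>.\<close>

lemma card_fixed_points_eq_signed_count:
  assumes fn: "\<forall>R\<in>\<P>. fully_normalized S F R"
    and alpha: "is_alpha S F P X \<theta>" and P: "P \<in> \<P>" and "Q \<in> \<P>"
  shows "int (card (fixed_points X \<theta> Q)) = int (order (W_grp S P)) * signed_count Q P"
  using \<open>Q \<in> \<P>\<close>
proof (induction "order S - card Q" arbitrary: Q rule: less_induct)
  case less
  note Q = reps_subgroup[OF less.prems] and P' = reps_subgroup[OF P]
  have stable: "stable_set S F X \<theta>"
    and count: "orbit_count S X \<theta> Q = (if fusion_conj F Q P then 1 else 0)"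
    using alpha fn less.prems by (auto simp: is_alpha_def)
  \<comment> \<open>Both are the representative of the class of \<open>P\<close>. This replaces
    \<open>W_grp S Q\<close> by \<open>W_grp S P\<close> in the one case where the orbit count is
    nonzero.\<close>
  have "fusion_conj F Q P \<Longrightarrow> Q = P"
    using rep_unique[OF P'] less.prems P fusion_conj_refl[OF P'] by metis
  then have "int (orbit_count S X \<theta> Q * order (W_grp S Q))
      = int (order (W_grp S P)) * (if fusion_conj F Q P then 1 else 0)"
    using count by (cases "fusion_conj F Q P") auto
  moreover have "(\<Sum>\<tau>\<in>long_chains Q. (-1) ^ chain_length \<tau> * int (card (fixed_points X \<theta> (rep (last \<tau>)))))
      = int (order (W_grp S P)) * (\<Sum>\<tau>\<in>long_chains Q. (-1) ^ chain_length \<tau> * signed_count (rep (last \<tau>)) P)"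
    unfolding sum_distrib_left
  proof (rule sum.cong[OF refl])
    fix \<tau> assume \<tau>: "\<tau> \<in> long_chains Q"
    have "int (card (fixed_points X \<theta> (rep (last \<tau>))))
        = int (order (W_grp S P)) * signed_count (rep (last \<tau>)) P"
      using less.hyps card_rep_last[OF \<tau>] rep_mem long_chains_last(1)[OF \<tau>] by simp
    then show "(-1) ^ chain_length \<tau> * int (card (fixed_points X \<theta> (rep (last \<tau>))))
        = int (order (W_grp S P)) * ((-1) ^ chain_length \<tau> * signed_count (rep (last \<tau>)) P)"
      by simp
  qed
  ultimately show ?case
    unfolding card_fixed_points_rec[OF stable Q] signed_count_rec[OF less.prems P']
    by (simp add: right_diff_distrib)
qed

end

theorem theorem4p9:
  fixes S :: "('a, 'b) monoid_scheme" and p :: nat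
    and F :: "'a set \<Rightarrow> 'a set \<Rightarrow> ('a \<Rightarrow> 'a) set"
    and Pstar :: "'a set set" and P Q :: "'a set"
    and X :: "'x set" and \<theta> :: "'a \<Rightarrow> 'x \<Rightarrow> 'x"
  assumes "saturated_fusion_system S p F"
    and "conj_class_reps S F Pstar"
    and "\<forall>R\<in>Pstar. fully_normalized S F R"
    and "Q \<in> Pstar" and "P \<in> Pstar"
    and "is_alpha S F P X \<theta>"
  shows "int (card (fixed_points X \<theta> Q)) =
    int (order (W_grp S P)) *
      (\<Sum>\<sigma>\<in>tethered_broken_chains S F Pstar Q P. (-1) ^ total_length \<sigma>)"
proof -
  interpret saturated_fusion_system S p F by fact
  interpret fusion_system_reps S p F Pstar by unfold_locales fact
  show ?thesis
    using card_fixed_points_eq_signed_count assms by (simp add: signed_count_def)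
qed

end
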